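(* Let $\alpha_0>0$, $\gamma\ge\alpha_0$ and $\kappa>1$. The "optimal" barrier level $\beta_2^*$, defined as the solution $\beta\in(\gamma,\infty)$ of $$\zeta_{1} \left( \gamma^{1-\zeta_{2}}\kappa(\zeta_{1}-\zeta_{2})\beta^{\zeta_{1}}+(\zeta_2-1)\gamma^{\zeta_{1}-\zeta_{2}}\beta+(1-\zeta_1)\beta^{1-\zeta_{2}+\zeta_{1}} \right)=0,$$ exists and is unique.
   Context: $\mu_A,\mu_L,\delta\in\mathbb R$, $\sigma_A>0$, $\sigma_L>0$, $\rho\in(-1,1)$ are constants with $\delta>\mu_A>\mu_L$ and $\delta>0$. Put $\tilde\sigma^2=\sigma_A^2+\sigma_L^2-2\rho\sigma_A\sigma_L$ and $$\zeta_{1},\zeta_2=\frac{\frac12\tilde\sigma^2-(\mu_A-\mu_L)\mp\sqrt{\frac14\tilde\sigma^4+(\mu_A-\mu_L)^2-\tilde\sigma^2(\mu_A+\mu_L-2\delta)}}{\tilde\sigma^2},$$ with the minus sign for $\zeta_1$ (so $\zeta_1<0$) and the plus sign for $\zeta_2$ (so $\zeta_2>1$). Here $\beta$ is a dividend barrier and $\gamma$ a capital injection barrier, required to satisfy $\alpha_0\le\gamma<\beta$. *)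

theory Defs
  imports Complex_Main
begin

definition sigma_tilde_sq :: "real \<Rightarrow> real \<Rightarrow> real \<Rightarrow> real" where
  "sigma_tilde_sq \<sigma>A \<sigma>L \<rho> = \<sigma>A\<^sup>2 + \<sigma>L\<^sup>2 - 2 * \<rho> * \<sigma>A * \<sigma>L"

text \<open>The argument \<open>s2\<close> stands for the squared volatility, so its square is the fourth power
  of the volatility.\<close>

definition zeta_discr :: "real \<Rightarrow> real \<Rightarrow> real \<Rightarrow> real \<Rightarrow> real" where
  "zeta_discr \<mu>A \<mu>L \<delta> s2 =
     s2\<^sup>2 / 4 + (\<mu>A - \<mu>L)\<^sup>2 - s2 * (\<mu>A + \<mu>L - 2 * \<delta>)"

definition zeta1 :: "real \<Rightarrow> real \<Rightarrow> real \<Rightarrow> real \<Rightarrow> real \<Rightarrow> real \<Rightarrow> real" where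
  "zeta1 \<mu>A \<mu>L \<delta> \<sigma>A \<sigma>L \<rho> =
     (let s2 = sigma_tilde_sq \<sigma>A \<sigma>L \<rho>
      in (s2 / 2 - (\<mu>A - \<mu>L) - sqrt (zeta_discr \<mu>A \<mu>L \<delta> s2)) / s2)"

definition zeta2 :: "real \<Rightarrow> real \<Rightarrow> real \<Rightarrow> real \<Rightarrow> real \<Rightarrow> real \<Rightarrow> real" where
  "zeta2 \<mu>A \<mu>L \<delta> \<sigma>A \<sigma>L \<rho> =
     (let s2 = sigma_tilde_sq \<sigma>A \<sigma>L \<rho>
      in (s2 / 2 - (\<mu>A - \<mu>L) + sqrt (zeta_discr \<mu>A \<mu>L \<delta> s2)) / s2)"

end

theory Submission
  imports Defs
begin

text \<open>
  Write \<open>a = 1 - \<zeta>1\<close> and \<open>b = \<zeta>2 - 1\<close>. Since the squared volatility \<open>s2\<close> is positive, both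
  are positive: \<open>\<delta> > \<mu>L\<close> gives \<open>\<zeta>1 < 0\<close> and \<open>\<delta> > \<mu>A\<close> gives \<open>\<zeta>2 > 1\<close>. Only the ratio
  \<open>x = \<beta> / \<gamma>\<close> of the two barriers matters: dividing by the nonzero factor
  \<open>\<zeta>1 * \<gamma> powr (1 - \<zeta>2) * \<beta> powr \<zeta>1\<close> turns the equation into
  \<open>b * x powr a + a * x powr (- b) = \<kappa> * (a + b)\<close> with \<open>x > 1\<close>.

  The function on the left takes the value \<open>a + b\<close> at \<open>x = 1\<close>, is strictly increasing for
  \<open>x \<ge> 1\<close>, and is unbounded. Since \<open>\<kappa> > 1\<close>, the value \<open>\<kappa> * (a + b)\<close> lies strictly above the
  value at \<open>1\<close>, so it is attained exactly once, by the intermediate value theorem and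
  monotonicity.
\<close>

text \<open>
  The derivative is \<open>a * b * (x powr (a - 1) - x powr (- b - 1))\<close>: the weights \<open>a\<close> and \<open>b\<close> are such
  that it changes sign exactly at \<open>x = 1\<close>.
\<close>

lemma weighted_powr_sum_strict_mono:
  fixes a b x y :: real
  assumes "a > 0" "b > 0" "1 \<le> x" "x < y"
  shows "b * x powr a + a * x powr (- b) < b * y powr a + a * y powr (- b)"
proof (rule DERIV_pos_imp_increasing_open [OF \<open>x < y\<close>])
  fix t assume "x < t" "t < y"
  hence t: "t > 1" using assms by simp
  have "((\<lambda>t. b * t powr a + a * t powr (- b)) has_real_derivative
          a * b * (t powr (a - 1) - t powr (- b - 1))) (at t)"
    using t by (auto intro!: derivative_eq_intros simp: algebra_simps)
  moreover have "t powr (- b - 1) < t powr (a - 1)"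
    using t assms by (intro powr_less_mono) auto
  ultimately show "\<exists>d. ((\<lambda>t. b * t powr a + a * t powr (- b)) has_real_derivative d) (at t) \<and> 0 < d"
    using assms by (intro exI[of _ "a * b * (t powr (a - 1) - t powr (- b - 1))"] conjI) auto
next
  show "continuous_on {x..y} (\<lambda>t. b * t powr a + a * t powr (- b))"
    using assms by (auto intro!: continuous_intros)
qed

lemma weighted_powr_sum_unique_solution:
  fixes a b c :: real
  assumes "a > 0" "b > 0" "c > a + b"
  shows "\<exists>!x. x > 1 \<and> b * x powr a + a * x powr (- b) = c"
proof -
  let ?g = "\<lambda>x::real. b * x powr a + a * x powr (- b)"
  \<comment> \<open>At this point the first summand alone equals \<open>c\<close>.\<close>
  define u where "u = (c / b) powr (1 / a)"
  have "u > 1"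
    unfolding u_def using assms by (intro gr_one_powr) (auto simp: field_simps)
  have "b * u powr a = c"
    unfolding u_def using assms by (simp add: powr_powr)
  hence "c \<le> ?g u" using assms by simp
  moreover have "?g 1 \<le> c" using assms by simp
  moreover have "continuous_on {1..u} ?g"
    by (auto intro!: continuous_intros)
  ultimately obtain x where x: "1 \<le> x" "?g x = c"
    using IVT'[of ?g 1 c u] \<open>u > 1\<close> by auto
  moreover have "x \<noteq> 1" using x assms by auto
  moreover have "y = z" if "y > 1" "z > 1" "?g y = c" "?g z = c" for y z
    using weighted_powr_sum_strict_mono[OF assms(1,2), of y z]
      weighted_powr_sum_strict_mono[OF assms(1,2), of z y] that
    by (cases y z rule: linorder_cases) auto
  ultimately show ?thesis
    by (intro ex1I[of _ x]) (force, force)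
qed

text \<open>Completing the square leaves a positive remainder because \<open>\<rho> < 1\<close>.\<close>

lemma sigma_tilde_sq_pos:
  assumes "\<sigma>A > 0" "\<sigma>L > 0" "\<rho> < 1"
  shows "sigma_tilde_sq \<sigma>A \<sigma>L \<rho> > 0"
proof -
  have "sigma_tilde_sq \<sigma>A \<sigma>L \<rho> = (\<sigma>A - \<sigma>L)\<^sup>2 + 2 * (1 - \<rho>) * \<sigma>A * \<sigma>L"
    by (simp add: sigma_tilde_sq_def power2_eq_square algebra_simps)
  thus ?thesis using assms by (simp add: add_nonneg_pos)
qed

text \<open>
  The discriminant equals \<open>(s2 / 2 - (\<mu>A - \<mu>L))\<^sup>2 + 2 * s2 * (\<delta> - \<mu>L)\<close>, so its root exceeds the
  remaining part of the numerator.
\<close>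

lemma zeta1_neg:
  assumes "sigma_tilde_sq \<sigma>A \<sigma>L \<rho> > 0" "\<mu>L < \<delta>"
  shows "zeta1 \<mu>A \<mu>L \<delta> \<sigma>A \<sigma>L \<rho> < 0"
proof -
  define s where "s = sigma_tilde_sq \<sigma>A \<sigma>L \<rho>"
  have s: "s > 0" using assms by (simp add: s_def)
  have "zeta_discr \<mu>A \<mu>L \<delta> s = (s / 2 - (\<mu>A - \<mu>L))\<^sup>2 + 2 * s * (\<delta> - \<mu>L)"
    by (simp add: zeta_discr_def power2_eq_square field_simps)
  hence "(s / 2 - (\<mu>A - \<mu>L))\<^sup>2 < zeta_discr \<mu>A \<mu>L \<delta> s"
    using s assms by simp
  hence "s / 2 - (\<mu>A - \<mu>L) < sqrt (zeta_discr \<mu>A \<mu>L \<delta> s)"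
    by (rule real_less_rsqrt)
  thus ?thesis
    using s by (simp add: zeta1_def Let_def s_def[symmetric] divide_less_0_iff)
qed

text \<open>
  The discriminant also equals \<open>(s2 / 2 + (\<mu>A - \<mu>L))\<^sup>2 + 2 * s2 * (\<delta> - \<mu>A)\<close>, which is the form
  suited to comparing the numerator with \<open>s2\<close>.
\<close>

lemma zeta2_gt_1:
  assumes "sigma_tilde_sq \<sigma>A \<sigma>L \<rho> > 0" "\<mu>A < \<delta>"
  shows "zeta2 \<mu>A \<mu>L \<delta> \<sigma>A \<sigma>L \<rho> > 1"
proof -
  define s where "s = sigma_tilde_sq \<sigma>A \<sigma>L \<rho>"
  have s: "s > 0" using assms by (simp add: s_def)
  have "zeta_discr \<mu>A \<mu>L \<delta> s = (s / 2 + (\<mu>A - \<mu>L))\<^sup>2 + 2 * s * (\<delta> - \<mu>A)"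
    by (simp add: zeta_discr_def power2_eq_square field_simps)
  hence "(s / 2 + (\<mu>A - \<mu>L))\<^sup>2 < zeta_discr \<mu>A \<mu>L \<delta> s"
    using s assms by simp
  hence "s / 2 + (\<mu>A - \<mu>L) < sqrt (zeta_discr \<mu>A \<mu>L \<delta> s)"
    by (rule real_less_rsqrt)
  thus ?thesis
    using s by (simp add: zeta2_def Let_def s_def[symmetric] field_simps)
qed

text \<open>
  Substituting \<open>\<beta> = \<gamma> * x\<close> gives all three terms the same power of \<open>\<gamma>\<close>. Once \<open>x powr z1\<close> is
  taken out as well, the term carrying \<open>\<kappa>\<close> is constant in \<open>x\<close>.
\<close>

lemma barrier_equation_factorization:
  fixes \<gamma> x z1 z2 \<kappa> :: real
  assumes "\<gamma> > 0" "x > 0"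
  shows "\<gamma> powr (1 - z2) * \<kappa> * (z1 - z2) * (\<gamma> * x) powr z1
          + (z2 - 1) * \<gamma> powr (z1 - z2) * (\<gamma> * x)
          + (1 - z1) * (\<gamma> * x) powr (1 - z2 + z1)
       = \<gamma> powr (1 - z2 + z1) * x powr z1 *
          ((z2 - 1) * x powr (1 - z1) + (1 - z1) * x powr (- (z2 - 1)) - \<kappa> * ((1 - z1) + (z2 - 1)))"
proof -
  let ?G = "\<gamma> powr (1 - z2 + z1)" and ?X = "x powr z1"
  have t1: "\<gamma> powr (1 - z2) * (\<gamma> * x) powr z1 = ?G * ?X"
    using assms by (simp add: powr_mult powr_add)
  have t2: "\<gamma> powr (z1 - z2) * (\<gamma> * x) = ?G * (?X * x powr (1 - z1))"
    using powr_add[of \<gamma> "z1 - z2" 1] powr_add[of x z1 "1 - z1"] assms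
    by (simp add: algebra_simps)
  have t3: "(\<gamma> * x) powr (1 - z2 + z1) = ?G * (?X * x powr (- (z2 - 1)))"
    using powr_add[of x z1 "- (z2 - 1)"] assms by (simp add: powr_mult algebra_simps)
  have "\<gamma> powr (1 - z2) * \<kappa> * (z1 - z2) * (\<gamma> * x) powr z1
          + (z2 - 1) * \<gamma> powr (z1 - z2) * (\<gamma> * x)
          + (1 - z1) * (\<gamma> * x) powr (1 - z2 + z1)
      = \<kappa> * (z1 - z2) * (\<gamma> powr (1 - z2) * (\<gamma> * x) powr z1)
          + (z2 - 1) * (\<gamma> powr (z1 - z2) * (\<gamma> * x))
          + (1 - z1) * (\<gamma> * x) powr (1 - z2 + z1)"
    by (simp only: mult_ac)
  also have "\<dots> = ?G * ?X *
      ((z2 - 1) * x powr (1 - z1) + (1 - z1) * x powr (- (z2 - 1)) - \<kappa> * ((1 - z1) + (z2 - 1)))"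
    unfolding t1 t2 t3 by (simp add: algebra_simps)
  finally show ?thesis .
qed

theorem lemma3p2:
  fixes \<mu>A \<mu>L \<delta> \<sigma>A \<sigma>L \<rho> \<zeta>1 \<zeta>2 \<alpha>0 \<gamma> \<kappa> :: real
  assumes "\<sigma>A > 0" and "\<sigma>L > 0"
    and "-1 < \<rho>" and "\<rho> < 1"
    and "\<delta> > \<mu>A" and "\<mu>A > \<mu>L" and "\<delta> > 0"
    and "\<zeta>1 = zeta1 \<mu>A \<mu>L \<delta> \<sigma>A \<sigma>L \<rho>"
    and "\<zeta>2 = zeta2 \<mu>A \<mu>L \<delta> \<sigma>A \<sigma>L \<rho>"
    and "\<alpha>0 > 0" and "\<gamma> \<ge> \<alpha>0" and "\<kappa> > 1"
  shows "\<exists>!\<beta>::real. \<beta> \<in> {\<gamma><..} \<and>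
    \<zeta>1 * (\<gamma> powr (1 - \<zeta>2) * \<kappa> * (\<zeta>1 - \<zeta>2) * \<beta> powr \<zeta>1
          + (\<zeta>2 - 1) * \<gamma> powr (\<zeta>1 - \<zeta>2) * \<beta>
          + (1 - \<zeta>1) * \<beta> powr (1 - \<zeta>2 + \<zeta>1)) = 0"
proof -
  let ?F = "\<lambda>\<beta>. \<zeta>1 * (\<gamma> powr (1 - \<zeta>2) * \<kappa> * (\<zeta>1 - \<zeta>2) * \<beta> powr \<zeta>1
          + (\<zeta>2 - 1) * \<gamma> powr (\<zeta>1 - \<zeta>2) * \<beta>
          + (1 - \<zeta>1) * \<beta> powr (1 - \<zeta>2 + \<zeta>1))"
  define a b where "a = 1 - \<zeta>1" and "b = \<zeta>2 - 1"
  have s: "sigma_tilde_sq \<sigma>A \<sigma>L \<rho> > 0"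
    using assms by (intro sigma_tilde_sq_pos)
  have z1: "\<zeta>1 < 0" using zeta1_neg[OF s] assms by simp
  have z2: "\<zeta>2 > 1" using zeta2_gt_1[OF s] assms by simp
  have \<gamma>: "\<gamma> > 0" using assms by simp
  have ab: "a > 0" "b > 0" using z1 z2 by (simp_all add: a_def b_def)
  have F_iff: "?F (\<gamma> * x) = 0 \<longleftrightarrow> b * x powr a + a * x powr (- b) = \<kappa> * (a + b)" if "x > 1" for x
    using barrier_equation_factorization[of \<gamma> x \<zeta>2 \<kappa> \<zeta>1] that \<gamma> z1
    by (simp add: a_def b_def)
  have "\<kappa> * (a + b) > a + b"
    using ab \<open>\<kappa> > 1\<close> by simp
  then obtain x where x: "x > 1" "b * x powr a + a * x powr (- b) = \<kappa> * (a + b)"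
    and uniq: "\<And>y. y > 1 \<Longrightarrow> b * y powr a + a * y powr (- b) = \<kappa> * (a + b) \<Longrightarrow> y = x"
    using weighted_powr_sum_unique_solution[OF ab] by blast
  show ?thesis
  proof (rule ex1I[of _ "\<gamma> * x"])
    show "\<gamma> * x \<in> {\<gamma><..} \<and> ?F (\<gamma> * x) = 0"
      using F_iff[OF x(1)] x \<gamma> by simp
  next
    fix \<beta> assume \<beta>: "\<beta> \<in> {\<gamma><..} \<and> ?F \<beta> = 0"
    hence ratio: "\<beta> / \<gamma> > 1" "\<gamma> * (\<beta> / \<gamma>) = \<beta>"
      using \<gamma> by simp_all
    hence "\<beta> / \<gamma> = x"
      using F_iff[OF ratio(1)] \<beta> by (intro uniq) simp_all
    thus "\<beta> = \<gamma> * x" using ratio by simp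
  qed
qed

end
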